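(* Let $K\subset\mathbb{R}^d$ be a convex, origin-symmetric body, let $\Gamma\subset\mathbb{R}^d$ be a lattice of rank $d$, and let $\xi\in\mathbb{S}^{d-1}$ be a unit vector. Then $$\#(K\cap\xi^\perp\cap\Gamma)\;\ge\;9^{-(d-1)}\,\#\big(K\cap(\xi^\perp+t\xi)\cap\Gamma\big)\qquad\text{for all } t\in\mathbb{R}.$$
   Context: A convex body in $\mathbb{R}^d$ is a convex compact subset equal to the closure of its interior; it is origin-symmetric if $K=-K$. A lattice is a discrete additive subgroup of $\mathbb{R}^d$, and its rank is the dimension of its linear span. Here $\#(A\cap\Gamma)=\mathrm{card}(A\cap\Gamma)$ is the number of points of $\Gamma$ in $A$, and $\xi^\perp=\{x\in\mathbb{R}^d: x\cdot\xi=0\}$. *)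

theory Defs
  imports "HOL-Analysis.Analysis"
begin

definition convex_body :: "'a::euclidean_space set \<Rightarrow> bool" where
  "convex_body K \<longleftrightarrow> convex K \<and> compact K \<and> K = closure (interior K)"

definition origin_symmetric :: "'a::real_vector set \<Rightarrow> bool" where
  "origin_symmetric K \<longleftrightarrow> uminus ` K = K"

definition additive_subgroup_set :: "'a::ab_group_add set \<Rightarrow> bool" where
  "additive_subgroup_set G \<longleftrightarrow>
     0 \<in> G \<and> (\<forall>x\<in>G. \<forall>y\<in>G. x + y \<in> G) \<and> (\<forall>x\<in>G. - x \<in> G)"

definition lattice_set :: "'a::euclidean_space set \<Rightarrow> bool" where
  "lattice_set \<Gamma> \<longleftrightarrow> additive_subgroup_set \<Gamma> \<and> discrete \<Gamma>"

definition lattice_rank :: "'a::euclidean_space set \<Rightarrow> nat" where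
  "lattice_rank \<Gamma> = dim (span \<Gamma>)"

definition perp_hyperplane :: "'a::euclidean_space \<Rightarrow> 'a set" where
  "perp_hyperplane \<xi> = {x. x \<bullet> \<xi> = 0}"

end

(*
  If two lattice points a, b of the slice K \<inter> (\<xi>\<^sup>\<bottom> + t\<xi>) are congruent modulo 2\<Gamma>, then
  (a - b) / 2 is a lattice point of K \<inter> \<xi>\<^sup>\<bottom>, by convexity and symmetry of K.  So each class
  modulo 2\<Gamma> contributes at most #(K \<inter> \<xi>\<^sup>\<bottom> \<inter> \<Gamma>) points to the slice, and there are at most 2^d
  classes.  For d \<ge> 2 this suffices because 2^d \<le> 9^(d-1); for d = 1 the slice has at most one
  point.

  To bound the number of classes without a lattice basis: representatives s_1, ..., s_m serve as
  digits in base 2, and give m^k distinct lattice points of norm O(2^k), while a packing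
  argument bounds the number of such points by O(2^(kd)).  Letting k tend to infinity, m \<le> 2^d.
*)
theory Submission
  imports Defs
begin

text \<open>Volume comparison: the open balls of radius \<open>d\<close> about the points of
  \<open>F\<close> are pairwise disjoint and lie in the ball of radius \<open>R + d\<close> about
  0.\<close>

lemma card_packing_le:
  fixes F :: "'a::euclidean_space set"
  assumes fin: "finite F" and F: "F \<subseteq> cball 0 R" and d: "d > 0"
    and sep: "\<And>x y. \<lbrakk>x \<in> F; y \<in> F; x \<noteq> y\<rbrakk> \<Longrightarrow> 2 * d \<le> dist x y" and R: "R \<ge> 0"
  shows "real (card F) * d ^ DIM('a) \<le> (R + d) ^ DIM('a)"
proof -
  let ?v = "unit_ball_vol (real DIM('a))"
  have "pairwise (\<lambda>x y. disjnt (ball x d) (ball y d)) F"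
    unfolding pairwise_def disjnt_iff
  proof (intro ballI impI allI notI)
    fix x y z assume "x \<in> F" "y \<in> F" "x \<noteq> y" "z \<in> ball x d \<and> z \<in> ball y d"
    then show False
      using sep[of x y] dist_triangle2[of x y z] by (auto simp: dist_commute)
  qed
  then have "measure lborel (\<Union>x\<in>F. ball x d) = (\<Sum>x\<in>F. measure lborel (ball x d))"
    by (intro measure_UNION' fin) (auto intro: fmeasurableI[OF _ emeasure_lborel_ball_finite])
  also have "\<dots> = real (card F) * (?v * d ^ DIM('a))"
    using d by (simp add: content_ball)
  finally have "real (card F) * (?v * d ^ DIM('a)) = measure lborel (\<Union>x\<in>F. ball x d)" ..
  also have "\<dots> \<le> measure lborel (ball (0::'a) (R + d))"
  proof (rule measure_mono_fmeasurable)
    show "(\<Union>x\<in>F. ball x d) \<subseteq> ball 0 (R + d)"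
    proof
      fix z assume "z \<in> (\<Union>x\<in>F. ball x d)"
      then obtain x where "x \<in> F" "dist x z < d" by auto
      then show "z \<in> ball 0 (R + d)"
        using F dist_triangle[of 0 z x] by fastforce
    qed
  qed (auto intro: fmeasurableI[OF _ emeasure_lborel_ball_finite] borel_open)
  also have "\<dots> = ?v * (R + d) ^ DIM('a)"
    using d R by (simp add: content_ball)
  finally have "?v * (real (card F) * d ^ DIM('a)) \<le> ?v * (R + d) ^ DIM('a)"
    by (simp add: mult_ac)
  then show ?thesis by simp
qed

context
  fixes \<Gamma> :: "'a::euclidean_space set"
  assumes lattice: "lattice_set \<Gamma>"
begin

lemma lattice_zero: "0 \<in> \<Gamma>"
  and lattice_add: "\<lbrakk>x \<in> \<Gamma>; y \<in> \<Gamma>\<rbrakk> \<Longrightarrow> x + y \<in> \<Gamma>"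
  and lattice_minus: "x \<in> \<Gamma> \<Longrightarrow> - x \<in> \<Gamma>"
  using lattice unfolding lattice_set_def additive_subgroup_set_def by auto

lemma lattice_diff: "\<lbrakk>x \<in> \<Gamma>; y \<in> \<Gamma>\<rbrakk> \<Longrightarrow> x - y \<in> \<Gamma>"
  using lattice_add[of x "- y"] lattice_minus[of y] by simp

text \<open>A radius isolating 0 serves at every point, since the difference of two lattice points
  is again a lattice point.\<close>

lemma lattice_uniform_discrete: "uniform_discrete \<Gamma>"
proof -
  have "0 isolated_in \<Gamma>"
    using lattice lattice_zero by (simp add: lattice_set_def discrete_def)
  then obtain e where e: "e > 0" "\<And>y. \<lbrakk>y \<in> \<Gamma>; dist 0 y < e\<rbrakk> \<Longrightarrow> y = 0"
    unfolding isolated_in_dist_Ex_iff by blast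
  have "x = y" if "x \<in> \<Gamma>" "y \<in> \<Gamma>" "dist x y < e" for x y
    using e(2)[OF lattice_diff[OF that(1,2)]] that(3) by (simp add: dist_norm norm_minus_commute)
  with e(1) show ?thesis
    unfolding uniform_discrete_def by blast
qed

text \<open>\<open>F\<close> collects the sums of 2^i s_i over i < k with digits s_i in
  \<open>S\<close>. The radius comes from 1 + 2 + ... + 2^(k-1) = 2^k - 1.\<close>

lemma digit_expansions:
  assumes S: "finite S" "S \<subseteq> \<Gamma>" "S \<subseteq> cball 0 c" and c: "c \<ge> 0"
    and incong: "\<And>s s' h. \<lbrakk>s \<in> S; s' \<in> S; h \<in> \<Gamma>; s - s' = 2 *\<^sub>R h\<rbrakk> \<Longrightarrow> s = s'"
  shows "\<exists>F. finite F \<and> F \<subseteq> \<Gamma> \<and> F \<subseteq> cball 0 ((2 ^ k - 1) * c) \<and> card F = card S ^ k"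
proof (induction k)
  case 0
  show ?case
    by (rule exI[of _ "{0}"]) (simp add: lattice_zero)
next
  case (Suc k)
  then obtain F where F: "finite F" "F \<subseteq> \<Gamma>" "F \<subseteq> cball 0 ((2 ^ k - 1) * c)"
    "card F = card S ^ k" by auto
  let ?f = "\<lambda>(s, h). s + 2 *\<^sub>R h :: 'a"
  have "inj_on ?f (S \<times> F)"
  proof (rule inj_onI, clarsimp)
    fix s h s' h' assume *: "s \<in> S" "h \<in> F" "s' \<in> S" "h' \<in> F" "s + 2 *\<^sub>R h = s' + 2 *\<^sub>R h'"
    \<comment> \<open>Modulo 2\<Gamma> only the lowest digit survives, so incongruence of the digits
      recovers it; cancelling it recovers the rest.\<close>
    have "s - s' = 2 *\<^sub>R (h' - h)"
      using arg_cong[OF *(5), of "\<lambda>u. u - 2 *\<^sub>R h - s'"]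
      by (simp add: scaleR_right_diff_distrib)
    then have "s = s'"
      using * F incong lattice_diff[of h' h] by blast
    with *(5) show "s = s' \<and> h = h'" by simp
  qed
  then have "card (?f ` (S \<times> F)) = card S ^ Suc k"
    using F by (simp add: card_image card_cartesian_product)
  moreover have "?f ` (S \<times> F) \<subseteq> \<Gamma>"
    using S F lattice_add by (auto simp: scaleR_2 subset_iff)
  moreover have "norm (s + 2 *\<^sub>R h) \<le> (2 ^ Suc k - 1) * c" if "s \<in> S" "h \<in> F" for s h
  proof -
    have "norm s \<le> c" "norm h \<le> (2 ^ k - 1) * c"
      using that S F by auto
    then show ?thesis
      using norm_triangle_ineq[of s "2 *\<^sub>R h"] by (simp add: algebra_simps)
  qed
  ultimately show ?case
    using S F by (intro exI[of _ "?f ` (S \<times> F)"]) auto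
qed

lemma card_incongruent_mod_2_le:
  assumes S: "finite S" "S \<subseteq> \<Gamma>"
    and incong: "\<And>s s' h. \<lbrakk>s \<in> S; s' \<in> S; h \<in> \<Gamma>; s - s' = 2 *\<^sub>R h\<rbrakk> \<Longrightarrow> s = s'"
  shows "card S \<le> 2 ^ DIM('a)"
proof (rule ccontr)
  let ?n = "DIM('a)"
  assume "\<not> ?thesis"
  then have "2 ^ ?n < card S" by simp
  then have "(2::real) ^ ?n < real (card S)"
    by (metis of_nat_less_iff of_nat_numeral of_nat_power)
  then have gt: "1 < real (card S) / 2 ^ ?n" by simp
  obtain e where e: "e > 0" "\<And>x y. \<lbrakk>x \<in> \<Gamma>; y \<in> \<Gamma>; dist x y < e\<rbrakk> \<Longrightarrow> x = y"
    using lattice_uniform_discrete unfolding uniform_discrete_def by blast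
  \<comment> \<open>Half the separation of \<Gamma>, as the packing bound asks for distances of at
    least \<open>2 * d\<close>.\<close>
  define d where "d = e / 2"
  have d: "d > 0" using e by (simp add: d_def)
  obtain c where c: "c > 0" "\<And>s. s \<in> S \<Longrightarrow> norm s \<le> c"
    using finite_imp_bounded[OF S(1)] bounded_pos by blast
  \<comment> \<open>The right side does not depend on \<open>k\<close>, whereas powers of a ratio
    above 1 are unbounded.\<close>
  have bound: "(real (card S) / 2 ^ ?n) ^ k \<le> (c / d + 1) ^ ?n" for k
  proof -
    have "S \<subseteq> cball 0 c" "0 \<le> c" using c by auto
    with digit_expansions[OF S, of c k] incong obtain F where
      F: "finite F" "F \<subseteq> \<Gamma>" "F \<subseteq> cball 0 ((2 ^ k - 1) * c)" "card F = card S ^ k"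
      by blast
    have "2 * d \<le> dist x y" if "x \<in> F" "y \<in> F" "x \<noteq> y" for x y
      using e(2)[of x y] that F(2) by (force simp: d_def)
    then have "real (card F) * d ^ ?n \<le> ((2 ^ k - 1) * c + d) ^ ?n"
      using F d c by (intro card_packing_le) auto
    also have "\<dots> \<le> (2 ^ k * (c + d)) ^ ?n"
    proof (rule power_mono)
      have "1 * d \<le> 2 ^ k * d" using d by (intro mult_right_mono) auto
      then show "(2 ^ k - 1) * c + d \<le> 2 ^ k * (c + d)"
        using c by (simp add: algebra_simps)
    qed (use c d in auto)
    also have "\<dots> = (2 ^ ?n) ^ k * (c / d + 1) ^ ?n * d ^ ?n"
    proof -
      have "c + d = (c / d + 1) * d" using d by (simp add: field_simps)
      then show ?thesis
        by (simp add: power_mult_distrib mult.commute flip: power_mult)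
    qed
    finally show ?thesis
      using d F(4) by (simp add: power_divide field_simps)
  qed
  obtain k where "(c / d + 1) ^ ?n < (real (card S) / 2 ^ ?n) ^ k"
    using real_arch_pow[OF gt] by blast
  with bound[of k] show False by simp
qed

text \<open>Each point of \<open>A\<close> is determined by the representative of its class modulo
  2\<Gamma> and by half its difference from that representative, which lies in
  \<open>B\<close>.\<close>

lemma card_le_half_differences:
  fixes A B :: "'a set"
  assumes A: "finite A" "A \<subseteq> \<Gamma>" and B: "finite B"
    and half: "\<And>a b h. \<lbrakk>a \<in> A; b \<in> A; h \<in> \<Gamma>; a - b = 2 *\<^sub>R h\<rbrakk> \<Longrightarrow> h \<in> B"
  shows "card A \<le> 2 ^ DIM('a) * card B"
proof -
  define cong where "cong a x \<longleftrightarrow> (\<exists>h\<in>\<Gamma>. a - x = 2 *\<^sub>R h)" for a x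
  have cong_sym: "cong y x" if "cong x y" for x y
    using that lattice_minus unfolding cong_def
    by (metis minus_diff_eq scaleR_minus_right)
  have cong_trans: "cong x z" if xy: "cong x y" and yz: "cong y z" for x y z
  proof -
    obtain h h' where h: "h \<in> \<Gamma>" "h' \<in> \<Gamma>" "x - y = 2 *\<^sub>R h" "y - z = 2 *\<^sub>R h'"
      using xy yz unfolding cong_def by blast
    have "x - z = (x - y) + (y - z)" by simp
    also have "\<dots> = 2 *\<^sub>R (h + h')" unfolding h by (simp add: scaleR_right_distrib)
    finally show ?thesis
      using h lattice_add unfolding cong_def by blast
  qed
  define r where "r a = (SOME x. x \<in> A \<and> cong a x)" for a
  have r: "r a \<in> A" "cong a (r a)" if "a \<in> A" for a
  proof -
    have "cong a a" unfolding cong_def by (rule bexI[OF _ lattice_zero]) simp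
    with that have "a \<in> A \<and> cong a a" by simp
    then have "r a \<in> A \<and> cong a (r a)" unfolding r_def by (rule someI)
    then show "r a \<in> A" "cong a (r a)" by auto
  qed
  \<comment> \<open>Congruent points give \<open>SOME\<close> the same predicate, hence the same
    choice. This makes distinct representatives incongruent.\<close>
  have r_eq: "r a = r b" if "cong a b" for a b
  proof -
    have "cong a x \<longleftrightarrow> cong b x" for x
      using that cong_sym cong_trans by blast
    then show ?thesis unfolding r_def by simp
  qed
  have "s = s'" if ss: "s \<in> r ` A" "s' \<in> r ` A" "h \<in> \<Gamma>" "s - s' = 2 *\<^sub>R h" for s s' h
  proof -
    obtain a b where "a \<in> A" "b \<in> A" "s = r a" "s' = r b" using ss by blast
    moreover have "cong s s'" using ss unfolding cong_def by blast
    ultimately show ?thesis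
      using r cong_sym cong_trans r_eq by metis
  qed
  moreover have "r ` A \<subseteq> \<Gamma>" using r A by blast
  ultimately have classes: "card (r ` A) \<le> 2 ^ DIM('a)"
    using A by (intro card_incongruent_mod_2_le) auto
  let ?g = "\<lambda>a. (r a, (1 / 2) *\<^sub>R (a - r a))"
  have "?g a \<in> r ` A \<times> B" if "a \<in> A" for a
  proof -
    obtain h where "h \<in> \<Gamma>" "a - r a = 2 *\<^sub>R h"
      using r(2)[OF \<open>a \<in> A\<close>] unfolding cong_def by blast
    then show ?thesis
      using half[OF \<open>a \<in> A\<close> r(1)] that by simp
  qed
  moreover have "inj_on ?g A"
    by (rule inj_onI) auto
  ultimately have "card A \<le> card (r ` A \<times> B)"
    using A B by (intro card_inj_on_le[of ?g]) auto
  also have "\<dots> \<le> 2 ^ DIM('a) * card B"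
    using classes by (simp add: card_cartesian_product)
  finally show ?thesis .
qed

end

text \<open>The induction starts from 4 \<le> 9. The inequality fails at \<open>m = 0\<close>, which
  is why dimension 1 is treated separately below.\<close>

lemma two_pow_Suc_le_nine_pow: "m \<ge> 1 \<Longrightarrow> (2::nat) ^ Suc m \<le> 9 ^ m"
  by (induction m rule: dec_induct) auto

theorem theorem7:
  fixes K \<Gamma> :: "(real ^ 'n) set" and \<xi> :: "real ^ 'n"
  assumes "convex_body K" and "origin_symmetric K"
    and "lattice_set \<Gamma>" and "lattice_rank \<Gamma> = CARD('n)"
    and "norm \<xi> = 1"
  shows "\<forall>t::real.
    real (card (K \<inter> perp_hyperplane \<xi> \<inter> \<Gamma>)) \<ge>
      9 powi (- (int CARD('n) - 1)) *
        real (card (K \<inter> ((\<lambda>x. x + t *\<^sub>R \<xi>) ` perp_hyperplane \<xi>) \<inter> \<Gamma>))"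
proof
  fix t :: real
  define A where "A = K \<inter> ((\<lambda>x. x + t *\<^sub>R \<xi>) ` perp_hyperplane \<xi>) \<inter> \<Gamma>"
  define B where "B = K \<inter> perp_hyperplane \<xi> \<inter> \<Gamma>"
  have K: "convex K" "bounded K"
    using \<open>convex_body K\<close> by (auto simp: convex_body_def compact_imp_bounded)
  \<comment> \<open>\<open>card\<close> is 0 on infinite sets, so finiteness is what makes the
    cardinalities genuine counts.\<close>
  have "finite (K \<inter> \<Gamma>)"
    using lattice_uniform_discrete[OF \<open>lattice_set \<Gamma>\<close>] K(2)
    by (metis uniform_discrete_finite_iff uniform_discrete_subset bounded_Int inf_le2)
  then have fin: "finite A" "finite B"
    unfolding A_def B_def by (auto elim: rev_finite_subset)
  have perp: "(a - b) \<bullet> \<xi> = 0" if "a \<in> A" "b \<in> A" for a b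
    using that by (auto simp: A_def perp_hyperplane_def inner_left_distrib inner_diff_left)
  \<comment> \<open>Here \<open>h\<close> is the midpoint of \<open>a\<close> and
    \<open>- b\<close>, both in \<open>K\<close>, and the common height \<open>t\<close> of
    \<open>a\<close> and \<open>b\<close> cancels.\<close>
  have half: "h \<in> B" if "a \<in> A" "b \<in> A" "h \<in> \<Gamma>" and h: "a - b = 2 *\<^sub>R h" for a b h
  proof -
    have "a \<in> K" "- b \<in> K"
      using that \<open>origin_symmetric K\<close> by (auto simp: A_def origin_symmetric_def)
    then have "(1 / 2) *\<^sub>R a + (1 / 2) *\<^sub>R (- b) \<in> K"
      by (intro convexD[OF K(1)]) auto
    also have "(1 / 2) *\<^sub>R a + (1 / 2) *\<^sub>R (- b) = (1 / 2) *\<^sub>R (a - b)"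
      by (simp add: scaleR_right_diff_distrib)
    finally have "h \<in> K" using h by simp
    moreover have "h \<bullet> \<xi> = 0"
      using perp[OF that(1,2)] h by simp
    ultimately show ?thesis
      using that(3) by (simp add: B_def perp_hyperplane_def)
  qed
  have "card A \<le> 9 ^ (CARD('n) - 1) * card B"
  proof (cases "CARD('n) = 1")
    \<comment> \<open>The factor is now 9^0 = 1. The slice has at most one point, and if it has one
      then \<open>B\<close> contains 0.\<close>
    case True
    then obtain i :: 'n where i: "UNIV = {i}"
      by (metis card_1_singletonE)
    then have all_i: "j = i" for j :: 'n by blast
    have "\<xi> \<noteq> 0" using \<open>norm \<xi> = 1\<close> by auto
    then obtain j where "\<xi> $ j \<noteq> 0" by (auto simp: vec_eq_iff)
    then have xi: "\<xi> $ i \<noteq> 0" using all_i[of j] by simp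
    have A1: "a = b" if "a \<in> A" "b \<in> A" for a b
    proof -
      have "(a - b) \<bullet> \<xi> = (a - b) $ i * \<xi> $ i"
        unfolding inner_vec_def i by simp
      with perp[OF that] xi have "a $ i = b $ i" by simp
      then have "a $ j = b $ j" for j using all_i[of j] by simp
      then show ?thesis by (simp add: vec_eq_iff)
    qed
    show ?thesis
    proof (cases "A = {}")
      case False
      then obtain a where a: "a \<in> A" by blast
      with A1 have "A = {a}" by blast
      moreover have "0 \<in> B"
        using half[OF a a lattice_zero[OF \<open>lattice_set \<Gamma>\<close>]] by simp
      then have "card B \<ge> 1"
        using fin by (metis card_0_eq empty_iff less_one not_less)
      ultimately show ?thesis using True by simp
    qed simp
  next
    case False
    have "card A \<le> 2 ^ CARD('n) * card B"
      using card_le_half_differences[OF \<open>lattice_set \<Gamma>\<close> fin(1) _ fin(2) half]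
      by (simp add: A_def)
    also have "(2::nat) ^ CARD('n) \<le> 9 ^ (CARD('n) - 1)"
    proof -
      have "CARD('n) > 0" by simp
      with False have "CARD('n) - 1 \<ge> 1" by linarith
      from two_pow_Suc_le_nine_pow[OF this] show ?thesis by simp
    qed
    finally show ?thesis by simp
  qed
  then have "real (card A) \<le> real (9 ^ (CARD('n) - 1) * card B)"
    by (simp only: of_nat_le_iff)
  then have "real (card A) \<le> 9 ^ (CARD('n) - 1) * real (card B)" by simp
  then have "inverse (9 ^ (CARD('n) - 1)) * real (card A) \<le> real (card B)"
    by (simp add: field_simps)
  \<comment> \<open>The integer exponent matches the truncated natural subtraction because the
    dimension is at least 1.\<close>
  moreover have "(9::real) powi (- (int CARD('n) - 1)) = inverse (9 ^ (CARD('n) - 1))"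
  proof -
    have "CARD('n) \<ge> 1" by (simp add: Suc_leI)
    then have "int CARD('n) - 1 = int (CARD('n) - 1)" by simp
    then show ?thesis by (simp only: power_int_minus power_int_of_nat)
  qed
  ultimately show "9 powi (- (int CARD('n) - 1)) * real (card (K \<inter> ((\<lambda>x. x + t *\<^sub>R \<xi>) ` perp_hyperplane \<xi>) \<inter> \<Gamma>))
      \<le> real (card (K \<inter> perp_hyperplane \<xi> \<inter> \<Gamma>))"
    by (simp only: A_def B_def)
qed

end
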